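(* Let $G$ be a strongly topological gyrogroup and let $H$ be a locally compact metrizable strong subgyrogroup of $G$. If the quotient space $G/H$ is strongly Fréchet-Urysohn, then the space $G$ is also strongly Fréchet-Urysohn.
   Context: All topological spaces are assumed Hausdorff. A gyrogroup is a nonempty set $G$ with a binary operation $\oplus$ such that: (G1) there is a unique $0\in G$ with $0\oplus a=a=a\oplus 0$ for all $a$; (G2) each $x\in G$ has a unique inverse $\ominus x$ with $\ominus x\oplus x=0=x\oplus(\ominus x)$; (G3) for all $x,y\in G$ there is an automorphism $\mathrm{gyr}[x,y]$ of $(G,\oplus)$ with $x\oplus(y\oplus z)=(x\oplus y)\oplus\mathrm{gyr}[x,y](z)$ for all $z\in G$; (G4) $\mathrm{gyr}[x\oplus y,y]=\mathrm{gyr}[x,y]$ for all $x,y\in G$. A topological gyrogroup is a gyrogroup with a topology making $\oplus:G\times G\to G$ jointly continuous and $x\mapsto\ominus x$ continuous. It is a strongly topological gyrogroup if there is a neighborhood base $\mathscr U$ of $0$ with $\mathrm{gyr}[x,y](U)=U$ for all $U\in\mathscr U$ and $x,y\in G$. A subgyrogroup is a nonempty subset $H\subseteq G$ that is a gyrogroup under the inherited operation and such that $\mathrm{gyr}[a,b]$ restricts to an automorphism of $H$ for all $a,b\in H$. It is a strong subgyrogroup if $\mathrm{gyr}[x,y](H)=H$ for all $x,y\in G$. For such $H$ the left cosets $a\oplus H$ ($a\in G$) partition $G$; $G/H=\{a\oplus H:a\in G\}$ carries the quotient topology induced by $\pi:G\to G/H$, $\pi(a)=a\oplus H$. Subgyrogroups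 carry the subspace topology. A space $X$ is strongly Fréchet-Urysohn if for each $x\in X$ and every sequence $\{A_n:n\in\mathbb N\}$ of subsets of $X$ with $x\in\bigcap_{n\in\mathbb N}\overline{A_n}$ there exists a sequence $\{b_n:n\in\mathbb N\}$ in $X$ converging to $x$ and intersecting $A_n$ for infinitely many $n$. *)

theory Defs
  imports "HOL-Analysis.Analysis"
begin

section \<open>Gyrogroups\<close>

definition magma_aut :: "'a set \<Rightarrow> ('a \<Rightarrow> 'a \<Rightarrow> 'a) \<Rightarrow> ('a \<Rightarrow> 'a) \<Rightarrow> bool" where
  "magma_aut G add f \<longleftrightarrow>
     bij_betw f G G \<and> (\<forall>a\<in>G. \<forall>b\<in>G. f (add a b) = add (f a) (f b))"

definition is_identity :: "'a set \<Rightarrow> ('a \<Rightarrow> 'a \<Rightarrow> 'a) \<Rightarrow> 'a \<Rightarrow> bool" where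
  "is_identity G add z \<longleftrightarrow> z \<in> G \<and> (\<forall>a\<in>G. add z a = a \<and> add a z = a)"

definition gyro_zero :: "'a set \<Rightarrow> ('a \<Rightarrow> 'a \<Rightarrow> 'a) \<Rightarrow> 'a" where
  "gyro_zero G add = (THE z. is_identity G add z)"

definition is_inverse :: "'a set \<Rightarrow> ('a \<Rightarrow> 'a \<Rightarrow> 'a) \<Rightarrow> 'a \<Rightarrow> 'a \<Rightarrow> bool" where
  "is_inverse G add x y \<longleftrightarrow>
     y \<in> G \<and> add y x = gyro_zero G add \<and> add x y = gyro_zero G add"

definition gyro_inverse :: "'a set \<Rightarrow> ('a \<Rightarrow> 'a \<Rightarrow> 'a) \<Rightarrow> 'a \<Rightarrow> 'a" where
  "gyro_inverse G add x = (THE y. is_inverse G add x y)"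

text \<open>
  The gyrations are a parameter of the locale, but no additional data: left cancellation
  makes \<open>gyr x y\<close> unique on \<open>G\<close>, namely
  \<open>gyr x y z = \<ominus>(x \<oplus> y) \<oplus> (x \<oplus> (y \<oplus> z))\<close>.
  Nothing is said about the behaviour of \<open>add\<close> and \<open>gyr\<close> outside \<open>G\<close>.
\<close>

locale gyrogroup =
  fixes G :: "'a set"
    and add :: "'a \<Rightarrow> 'a \<Rightarrow> 'a"
    and gyr :: "'a \<Rightarrow> 'a \<Rightarrow> 'a \<Rightarrow> 'a"
  assumes nonempty: "G \<noteq> {}"
    and add_closed: "\<lbrakk>x \<in> G; y \<in> G\<rbrakk> \<Longrightarrow> add x y \<in> G"
    and ex1_identity: "\<exists>!z. is_identity G add z"
    and ex1_inverse: "x \<in> G \<Longrightarrow> \<exists>!y. is_inverse G add x y"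
    and gyr_aut: "\<lbrakk>x \<in> G; y \<in> G\<rbrakk> \<Longrightarrow> magma_aut G add (gyr x y)"
    and gyr_assoc:
      "\<lbrakk>x \<in> G; y \<in> G; z \<in> G\<rbrakk> \<Longrightarrow> add x (add y z) = add (add x y) (gyr x y z)"
    and gyr_loop: "\<lbrakk>x \<in> G; y \<in> G; z \<in> G\<rbrakk> \<Longrightarrow> gyr (add x y) y z = gyr x y z"

definition subgyrogroup ::
    "'a set \<Rightarrow> ('a \<Rightarrow> 'a \<Rightarrow> 'a) \<Rightarrow> ('a \<Rightarrow> 'a \<Rightarrow> 'a \<Rightarrow> 'a) \<Rightarrow> 'a set \<Rightarrow> bool" where
  "subgyrogroup G add gyr H \<longleftrightarrow>
     H \<noteq> {} \<and> H \<subseteq> G \<and> (\<exists>gyr'. gyrogroup H add gyr') \<and>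
     (\<forall>a\<in>H. \<forall>b\<in>H. magma_aut H add (gyr a b))"

definition strong_subgyrogroup ::
    "'a set \<Rightarrow> ('a \<Rightarrow> 'a \<Rightarrow> 'a) \<Rightarrow> ('a \<Rightarrow> 'a \<Rightarrow> 'a \<Rightarrow> 'a) \<Rightarrow> 'a set \<Rightarrow> bool" where
  "strong_subgyrogroup G add gyr H \<longleftrightarrow>
     subgyrogroup G add gyr H \<and> (\<forall>x\<in>G. \<forall>y\<in>G. gyr x y ` H = H)"

definition left_coset :: "('a \<Rightarrow> 'a \<Rightarrow> 'a) \<Rightarrow> 'a set \<Rightarrow> 'a \<Rightarrow> 'a set" where
  "left_coset add H a = add a ` H"


section \<open>Topological gyrogroups\<close>

text \<open>
  The carrier of the gyrogroup is \<open>topspace X\<close>. The Hausdorff property is not part of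
  these locales.
\<close>

locale topological_gyrogroup =
  gyrogroup "topspace X" add gyr
  for X :: "'a topology" and add :: "'a \<Rightarrow> 'a \<Rightarrow> 'a" and gyr :: "'a \<Rightarrow> 'a \<Rightarrow> 'a \<Rightarrow> 'a" +
  assumes continuous_add: "continuous_map (prod_topology X X) X (\<lambda>(x, y). add x y)"
    and continuous_inverse: "continuous_map X X (gyro_inverse (topspace X) add)"

text \<open>
  \<open>neighbourhood_base_at\<close> does not by itself force the members of the family to be
  neighbourhoods of the point, hence the first conjunct. Neighbourhoods need not be open.
\<close>

locale strongly_topological_gyrogroup = topological_gyrogroup +
  assumes invariant_base:
    "\<exists>\<U>. (\<forall>U\<in>\<U>. U \<subseteq> topspace X \<and> gyro_zero (topspace X) add \<in> X interior_of U) \<and>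
         neighbourhood_base_at (gyro_zero (topspace X) add) (\<lambda>U. U \<in> \<U>) X \<and>
         (\<forall>U\<in>\<U>. \<forall>x\<in>topspace X. \<forall>y\<in>topspace X. gyr x y ` U = U)"


section \<open>Quotient topologies\<close>

definition quotient_topology :: "'a topology \<Rightarrow> ('a \<Rightarrow> 'b) \<Rightarrow> 'b topology" where
  "quotient_topology X f =
     topology (\<lambda>V. V \<subseteq> f ` topspace X \<and> openin X {x \<in> topspace X. f x \<in> V})"

lemma openin_quotient_topology:
  "openin (quotient_topology X f) V \<longleftrightarrow>
     V \<subseteq> f ` topspace X \<and> openin X {x \<in> topspace X. f x \<in> V}"
proof -
  have "istopology (\<lambda>V. V \<subseteq> f ` topspace X \<and> openin X {x \<in> topspace X. f x \<in> V})"
    unfolding istopology_def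
  proof (intro conjI allI impI)
    fix S T
    assume S: "S \<subseteq> f ` topspace X \<and> openin X {x \<in> topspace X. f x \<in> S}"
      and T: "T \<subseteq> f ` topspace X \<and> openin X {x \<in> topspace X. f x \<in> T}"
    show "S \<inter> T \<subseteq> f ` topspace X" using S by blast
    have eq: "{x \<in> topspace X. f x \<in> S \<inter> T} =
        {x \<in> topspace X. f x \<in> S} \<inter> {x \<in> topspace X. f x \<in> T}" by auto
    show "openin X {x \<in> topspace X. f x \<in> S \<inter> T}"
      unfolding eq by (rule openin_Int) (use S T in simp_all)
  next
    fix \<K>
    assume K: "\<forall>V\<in>\<K>. V \<subseteq> f ` topspace X \<and> openin X {x \<in> topspace X. f x \<in> V}"
    show "\<Union>\<K> \<subseteq> f ` topspace X" using K by (intro Union_least) simp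
    have eq: "{x \<in> topspace X. f x \<in> \<Union>\<K>} = \<Union>((\<lambda>V. {x \<in> topspace X. f x \<in> V}) ` \<K>)" by auto
    show "openin X {x \<in> topspace X. f x \<in> \<Union>\<K>}"
      unfolding eq by (rule openin_Union) (use K in auto)
  qed
  then show ?thesis
    unfolding quotient_topology_def by (simp only: topology_inverse')
qed

lemma topspace_quotient_topology: "topspace (quotient_topology X f) = f ` topspace X"
proof
  show "topspace (quotient_topology X f) \<subseteq> f ` topspace X"
    using openin_quotient_topology[THEN iffD1, OF openin_topspace] by (rule conjunct1)
  have "{x \<in> topspace X. f x \<in> f ` topspace X} = topspace X" by blast
  then have "openin (quotient_topology X f) (f ` topspace X)"
    by (simp add: openin_quotient_topology)
  then show "f ` topspace X \<subseteq> topspace (quotient_topology X f)"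
    by (rule openin_subset)
qed

lemma quotient_map_quotient_topology: "quotient_map X (quotient_topology X f) f"
  by (simp add: quotient_map_def topspace_quotient_topology openin_quotient_topology)

definition coset_space :: "'a topology \<Rightarrow> ('a \<Rightarrow> 'a \<Rightarrow> 'a) \<Rightarrow> 'a set \<Rightarrow> 'a set topology" where
  "coset_space X add H = quotient_topology X (left_coset add H)"


section \<open>Strongly Frechet-Urysohn spaces\<close>

text \<open>
  ``Intersecting \<open>A n\<close> for infinitely many \<open>n\<close>'' is read index by index, as
  \<open>b n \<in> A n\<close>. Asking only that the range of \<open>b\<close> meets \<open>A n\<close> would be
  trivially satisfiable whenever the sets \<open>A n\<close> have a common point.
\<close>

definition strongly_Frechet_Urysohn :: "'a topology \<Rightarrow> bool" where
  "strongly_Frechet_Urysohn X \<longleftrightarrow>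
     (\<forall>x\<in>topspace X. \<forall>A::nat \<Rightarrow> 'a set.
        (\<forall>n. A n \<subseteq> topspace X) \<and> x \<in> (\<Inter>n. X closure_of A n) \<longrightarrow>
        (\<exists>b::nat \<Rightarrow> 'a. range b \<subseteq> topspace X \<and> limitin X b x sequentially \<and>
           infinite {n. b n \<in> A n}))"

end

(*
  After a translation it suffices to consider the point 0. Choose an open N around 0 whose trace on H
  lies in a compact K \<subseteq> H, an open V around 0 with -V + V \<subseteq> N, and, by regularity and metrizability,
  open U_n around 0 whose closures meet H only in 0. If 0 is adherent to every A_n, then the coset H is
  adherent to the images of A_n \<inter> V \<inter> U_0 \<inter> ... \<inter> U_n, so G/H supplies a sequence of cosets converging
  to H, which lifts to points b_n of these sets for infinitely many n. To see that b_n tends to 0, let P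
  be open around 0. Compactness gives m with K \<subseteq> Q, where Q is the union of P and the complements of
  the closures of U_0, ..., U_m; the tube lemma gives W around 0 with W + K \<subseteq> Q. Eventually b_n = w + h
  with w in W and h in H; then h = -w + b_n is in K, so b_n is in Q, that is, in P.
*)

theory Submission
  imports Defs
begin

section \<open>Algebra of gyrogroups\<close>

context gyrogroup
begin

abbreviation zero :: 'a where
  "zero \<equiv> gyro_zero G add"

abbreviation neg :: "'a \<Rightarrow> 'a" where
  "neg \<equiv> gyro_inverse G add"

lemma is_identity_zero: "is_identity G add zero"
  unfolding gyro_zero_def by (rule theI'[OF ex1_identity])

lemma zero_closed: "zero \<in> G"
  and add_zero_left: "a \<in> G \<Longrightarrow> add zero a = a"
  and add_zero_right: "a \<in> G \<Longrightarrow> add a zero = a"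
  using is_identity_zero by (auto simp: is_identity_def)

lemma is_inverse_neg: "a \<in> G \<Longrightarrow> is_inverse G add a (neg a)"
  unfolding gyro_inverse_def by (rule theI'[OF ex1_inverse])

lemma neg_closed: "a \<in> G \<Longrightarrow> neg a \<in> G"
  and add_neg_left: "a \<in> G \<Longrightarrow> add (neg a) a = zero"
  and add_neg_right: "a \<in> G \<Longrightarrow> add a (neg a) = zero"
  using is_inverse_neg[of a] by (auto simp: is_inverse_def)

lemma gyr_closed: "\<lbrakk>x \<in> G; y \<in> G; z \<in> G\<rbrakk> \<Longrightarrow> gyr x y z \<in> G"
  using gyr_aut[of x y] unfolding magma_aut_def bij_betw_def by blast

text \<open>Adding \<open>neg a\<close> on the left turns both sides, by the gyroassociative law,
  into images under \<open>gyr (neg a) a\<close>, which is injective on \<open>G\<close>.\<close>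

lemma add_left_imp_eq:
  assumes "a \<in> G" "b \<in> G" "c \<in> G" "add a b = add a c"
  shows "b = c"
proof -
  have "gyr (neg a) a b = gyr (neg a) a c"
    using assms gyr_assoc[of "neg a" a b] gyr_assoc[of "neg a" a c]
    by (simp add: neg_closed add_neg_left add_zero_left gyr_closed)
  moreover have "inj_on (gyr (neg a) a) G"
    using gyr_aut[of "neg a" a] assms(1) by (simp add: magma_aut_def bij_betw_def neg_closed)
  ultimately show ?thesis
    using assms by (meson inj_onD)
qed

text \<open>Gyroassociativity with first summand \<open>zero\<close> reads
  \<open>add a z = add a (gyr zero a z)\<close>; now cancel \<open>a\<close>.\<close>

lemma gyr_zero_left:
  assumes "a \<in> G" "z \<in> G"
  shows "gyr zero a z = z"
  using gyr_assoc[of zero a z] assms add_left_imp_eq[of a z "gyr zero a z"]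
  by (simp add: zero_closed add_zero_left add_closed gyr_closed)

text \<open>The loop property replaces \<open>gyr (neg a) a\<close> by \<open>gyr zero a\<close>,
  which fixes \<open>G\<close> pointwise, so the gyration in the associative law disappears.\<close>

lemma add_neg_add:
  assumes "a \<in> G" "x \<in> G"
  shows "add (neg a) (add a x) = x"
  using gyr_assoc[of "neg a" a x] gyr_loop[of "neg a" a x] assms
  by (simp add: neg_closed add_neg_left add_zero_left gyr_zero_left)

lemma add_add_neg:
  assumes "a \<in> G" "x \<in> G"
  shows "add a (add (neg a) x) = x"
  using gyr_assoc[of a "neg a" x] gyr_loop[of a "neg a" x] assms
  by (simp add: neg_closed add_neg_right add_zero_left gyr_zero_left)

section \<open>Subgyrogroups and their left cosets\<close>

lemma add_image_eq:
  assumes "a \<in> G"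
  shows "add a ` G = G"
proof (intro equalityI subsetI)
  fix x assume "x \<in> G"
  then show "x \<in> add a ` G"
    using add_add_neg[OF assms] assms by (metis add_closed neg_closed image_eqI)
qed (use assms add_closed in blast)

lemma zero_in_subgyrogroup:
  assumes "subgyrogroup G add gyr H"
  shows "zero \<in> H"
proof -
  obtain gyr' where "gyrogroup H add gyr'" and HG: "H \<subseteq> G"
    using assms by (auto simp: subgyrogroup_def)
  then interpret H: gyrogroup H add gyr' by simp
  have mem: "H.zero \<in> G"
    using H.zero_closed HG by blast
  \<comment> \<open>The identity of \<open>H\<close> is idempotent in \<open>G\<close>, so left
    cancellation in \<open>G\<close> identifies it with \<open>zero\<close>.\<close>
  have "H.zero = zero"
  proof (rule add_left_imp_eq[OF mem mem zero_closed])
    show "add H.zero H.zero = add H.zero zero"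
      by (simp only: H.add_zero_left[OF H.zero_closed] add_zero_right[OF mem])
  qed
  then show ?thesis
    using H.zero_closed by simp
qed

text \<open>Invariance of \<open>H\<close> under \<open>gyr x h\<close>, with \<open>x\<close>
  anywhere in \<open>G\<close>, lets the gyration be inserted for free: (x+h)+H = (x+h)+gyr[x,h](H)
  = x+(h+H) = x+H.\<close>

lemma left_coset_add:
  assumes "strong_subgyrogroup G add gyr H" "x \<in> G" "h \<in> H"
  shows "left_coset add H (add x h) = left_coset add H x"
proof -
  obtain gyr' where "gyrogroup H add gyr'" and HG: "H \<subseteq> G"
    and inv: "\<And>a b. \<lbrakk>a \<in> G; b \<in> G\<rbrakk> \<Longrightarrow> gyr a b ` H = H"
    using assms(1) by (auto simp: strong_subgyrogroup_def subgyrogroup_def)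
  then interpret H: gyrogroup H add gyr' by simp
  have hG: "h \<in> G"
    using assms(3) HG by blast
  have "add (add x h) ` H = add (add x h) ` (gyr x h ` H)"
    using inv assms(2) hG by simp
  also have "\<dots> = (\<lambda>k. add x (add h k)) ` H"
    unfolding image_image using gyr_assoc[OF assms(2) hG] HG by (intro image_cong) auto
  also have "\<dots> = add x ` (add h ` H)"
    by (simp add: image_image)
  also have "\<dots> = add x ` H"
    using H.add_image_eq[OF assms(3)] by simp
  finally show ?thesis
    by (simp add: left_coset_def)
qed

lemma left_coset_eqD:
  assumes "zero \<in> H" "a \<in> G" "left_coset add H a = left_coset add H b"
  shows "\<exists>h\<in>H. a = add b h"
proof -
  have "a \<in> left_coset add H a"
    unfolding left_coset_def using assms(1,2) add_zero_right by (metis image_eqI)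
  then show ?thesis
    using assms(3) by (auto simp: left_coset_def)
qed

end

section \<open>Topological gyrogroups\<close>

context topological_gyrogroup
begin

section \<open>Continuity of translations and differences, and its local consequences\<close>

lemma continuous_left_translation:
  assumes "a \<in> topspace X"
  shows "continuous_map X X (add a)"
proof -
  have "continuous_map X (prod_topology X X) (\<lambda>x. (a, x))"
    using assms by (intro continuous_intros) auto
  from continuous_map_compose[OF this continuous_add] show ?thesis
    by (simp add: o_def)
qed

lemma continuous_right_translation:
  assumes "a \<in> topspace X"
  shows "continuous_map X X (\<lambda>x. add x a)"
proof -
  have "continuous_map X (prod_topology X X) (\<lambda>x. (x, a))"
    using assms by (intro continuous_intros) auto
  from continuous_map_compose[OF this continuous_add] show ?thesis
    by (simp add: o_def)
qed

lemma continuous_left_difference: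
  "continuous_map (prod_topology X X) X (\<lambda>(x, y). add (neg x) y)"
proof -
  have "continuous_map (prod_topology X X) (prod_topology X X) (\<lambda>p. (neg (fst p), snd p))"
    using continuous_map_compose[OF continuous_map_fst continuous_inverse]
    by (intro continuous_map_pairedI continuous_map_snd) (simp add: o_def)
  from continuous_map_compose[OF this continuous_add] show ?thesis
    by (simp add: o_def case_prod_unfold)
qed

text \<open>Kept general in \<open>f\<close> because it serves both the sum and the left
  difference.\<close>

lemma square_neighbourhood:
  assumes "continuous_map (prod_topology X X) X (\<lambda>(x, y). f x y)"
    and "openin X N" "a \<in> topspace X" "f a a \<in> N"
  obtains V where "openin X V" "a \<in> V" "\<forall>x\<in>V. \<forall>y\<in>V. f x y \<in> N"
proof -
  have "openin (prod_topology X X) {p \<in> topspace (prod_topology X X). (\<lambda>(x, y). f x y) p \<in> N}"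
    using assms by (intro openin_continuous_map_preimage)
  moreover have "(a, a) \<in> {p \<in> topspace (prod_topology X X). (\<lambda>(x, y). f x y) p \<in> N}"
    using assms by simp
  ultimately obtain S T where "openin X S" "openin X T" "a \<in> S" "a \<in> T"
    and "S \<times> T \<subseteq> {p \<in> topspace (prod_topology X X). (\<lambda>(x, y). f x y) p \<in> N}"
    unfolding openin_prod_topology_alt by meson
  then show thesis
    by (intro that[of "S \<inter> T"]) (auto simp: openin_Int)
qed

text \<open>Regularity at \<open>zero\<close>. If V+V lies in \<open>U\<close> and \<open>x\<close>
  is adherent to \<open>V\<close>, some \<open>v\<close> in \<open>V\<close> is so close to
  \<open>x\<close> that \<open>add (neg v) x\<close> is in \<open>V\<close>; hence x = v+(-v+x) lies
  in V+V.\<close>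

lemma closed_neighbourhood_zero:
  assumes "openin X U" "zero \<in> U"
  obtains V where "openin X V" "zero \<in> V" "X closure_of V \<subseteq> U"
proof -
  obtain V where V: "openin X V" "zero \<in> V" "\<forall>x\<in>V. \<forall>y\<in>V. add x y \<in> U"
    by (rule square_neighbourhood[OF continuous_add assms(1) zero_closed])
      (simp_all add: assms(2) add_zero_left zero_closed)
  have VX: "V \<subseteq> topspace X"
    using V(1) by (rule openin_subset)
  have "x \<in> U" if x: "x \<in> X closure_of V" for x
  proof -
    have xX: "x \<in> topspace X"
      using x by (simp add: in_closure_of)
    have "continuous_map X X (\<lambda>v. add (neg v) x)"
      using continuous_map_compose[OF continuous_inverse continuous_right_translation[OF xX]]
      by (simp add: o_def)
    then have "openin X {v \<in> topspace X. add (neg v) x \<in> V}"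
      using V(1) by (rule openin_continuous_map_preimage)
    moreover have "x \<in> {v \<in> topspace X. add (neg v) x \<in> V}"
      using xX V(2) by (simp add: add_neg_left)
    ultimately have "\<exists>v. v \<in> V \<and> v \<in> {v \<in> topspace X. add (neg v) x \<in> V}"
      using x[unfolded in_closure_of] by (elim conjE allE) (rule mp, assumption, rule conjI)
    then obtain v where "v \<in> V" "add (neg v) x \<in> V"
      by blast
    then show ?thesis
      using V(3)[rule_format, of v "add (neg v) x"] VX xX by (auto simp: add_add_neg)
  qed
  then show thesis
    using V that by blast
qed

text \<open>Since zero+K = K, the compact rectangle \<open>{zero} \<times> K\<close> lies in the
  open preimage of \<open>Q\<close> under addition, and Wallace's theorem thickens it to an open
  rectangle.\<close>

lemma tube_neighbourhood_zero:
  assumes "compactin X K" "openin X Q" "K \<subseteq> Q"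
  obtains W where "openin X W" "zero \<in> W" "\<forall>w\<in>W. \<forall>h\<in>K. add w h \<in> Q"
proof -
  let ?R = "{p \<in> topspace (prod_topology X X). (\<lambda>(x, y). add x y) p \<in> Q}"
  have "K \<subseteq> topspace X"
    using assms(1) by (rule compactin_subset_topspace)
  then have sub: "{zero} \<times> K \<subseteq> ?R"
    using assms(3) by (auto simp: zero_closed add_zero_left subset_iff)
  have R: "openin (prod_topology X X) ?R"
    using continuous_add assms(2) by (rule openin_continuous_map_preimage)
  have "compactin X {zero}"
    by (simp add: zero_closed)
  from Wallace_theorem_prod_topology[OF this assms(1) R sub]
  obtain W T where "openin X W" "{zero} \<subseteq> W" "K \<subseteq> T" "W \<times> T \<subseteq> ?R" .
  then show thesis
    by (intro that[of W]) fast+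
qed

text \<open>The saturation of \<open>W\<close> is the union, over \<open>h\<close> in
  \<open>H\<close>, of the preimages of \<open>W\<close> under right translation by
  \<open>h\<close>, each of which is open.\<close>

lemma open_map_left_coset:
  assumes "strong_subgyrogroup (topspace X) add gyr H"
  shows "open_map X (coset_space X add H) (left_coset add H)"
  unfolding open_map_def
proof (intro allI impI)
  fix W assume W: "openin X W"
  have WX: "W \<subseteq> topspace X"
    using W by (rule openin_subset)
  have sub: "subgyrogroup (topspace X) add gyr H"
    using assms by (simp add: strong_subgyrogroup_def)
  then have HX: "H \<subseteq> topspace X" and H0: "zero \<in> H"
    by (simp add: subgyrogroup_def, rule zero_in_subgyrogroup)
  let ?S = "{x \<in> topspace X. left_coset add H x \<in> left_coset add H ` W}"
  have "\<exists>T. openin X T \<and> x \<in> T \<and> T \<subseteq> ?S" if x: "x \<in> ?S" for x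
  proof -
    obtain w where "w \<in> W" "left_coset add H w = left_coset add H x"
      using x by auto
    then obtain h where h: "h \<in> H" "add x h \<in> W"
      using left_coset_eqD[OF H0] WX by blast
    let ?T = "{y \<in> topspace X. add y h \<in> W}"
    have "openin X ?T"
      using h(1) HX
      by (intro openin_continuous_map_preimage[OF _ W] continuous_right_translation) blast
    moreover have "x \<in> ?T"
      using x h(2) by simp
    moreover have "?T \<subseteq> ?S"
      using left_coset_add[OF assms _ h(1)] by (auto intro: rev_image_eqI)
    ultimately show ?thesis
      by blast
  qed
  then have "openin X ?S"
    by (subst openin_subopen) blast
  then show "openin (coset_space X add H) (left_coset add H ` W)"
    using WX by (simp add: coset_space_def openin_quotient_topology image_mono)
qed

end

section \<open>Lifting convergent sequences of cosets\<close>

text \<open>The sets \<open>E m\<close> increase with \<open>m\<close>, so the member of largest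
  index in a finite subcover already covers \<open>K\<close>.\<close>

lemma compactin_Un_UNION_initial:
  fixes D :: "nat \<Rightarrow> 'a set"
  assumes "compactin X K" "openin X P" "\<And>i. openin X (D i)" "K \<subseteq> P \<union> (\<Union>i. D i)"
  obtains m where "K \<subseteq> P \<union> (\<Union>i\<le>m. D i)"
proof -
  define E where "E m = P \<union> (\<Union>i\<le>m. D i)" for m
  have "K \<subseteq> \<Union>(range E)"
    using assms(4) by (fastforce simp: E_def)
  moreover have "openin X (E m)" for m
    unfolding E_def using assms(2,3) by (intro openin_Un openin_Union) auto
  ultimately obtain \<F> where "finite \<F>" "\<F> \<subseteq> range E" "K \<subseteq> \<Union>\<F>"
    using compactinD[OF assms(1), of "range E"] by blast
  then obtain N where N: "finite N" "K \<subseteq> \<Union>(E ` N)"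
    by (metis finite_subset_image)
  have "E n \<subseteq> E (Max N)" if "n \<in> N" for n
    using Max_ge[OF N(1) that] unfolding E_def by fastforce
  \<comment> \<open>This also holds when \<open>N\<close> is empty, whatever \<open>Max N\<close>
    is, because \<open>K\<close> is then empty.\<close>
  then have "K \<subseteq> E (Max N)"
    using N(2) by blast
  then show thesis
    using that unfolding E_def by blast
qed

section \<open>Neighborhoods of the identity adapted to \<open>H\<close>, and convergence to the
  identity\<close>

context topological_gyrogroup
begin

text \<open>A point of a metrizable space is a G-delta. Each relatively open \<open>C n\<close> is
  the trace of an open set of \<open>X\<close>, inside which regularity finds the closure of some
  \<open>U n\<close>.\<close>

lemma neighbourhoods_separating_zero:
  assumes "zero \<in> H" "metrizable_space (subtopology X H)"
  obtains U :: "nat \<Rightarrow> 'a set" where "\<forall>n. openin X (U n)" "\<forall>n. zero \<in> U n"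
    "H \<inter> (\<Inter>n. X closure_of U n) \<subseteq> {zero}"
proof -
  have "closedin (subtopology X H) {zero}"
    using assms metrizable_imp_t1_space
    by (intro closedin_t1_singleton) (auto simp: zero_closed)
  then have "gdelta_in (subtopology X H) {zero}"
    by (rule closed_imp_gdelta_in[OF assms(2)])
  then obtain C where C: "\<And>n::nat. openin (subtopology X H) (C n)" "\<Inter>(range C) = {zero}"
    by (auto simp: gdelta_in_descending)
  have "\<exists>U. openin X U \<and> zero \<in> U \<and> H \<inter> X closure_of U \<subseteq> C n" for n
  proof -
    obtain R where R: "openin X R" "C n = R \<inter> H"
      using C(1) by (auto simp: openin_subtopology)
    have "zero \<in> R"
      using C(2) R(2) by blast
    obtain U where "openin X U" "zero \<in> U" "X closure_of U \<subseteq> R"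
      by (rule closed_neighbourhood_zero[OF R(1) \<open>zero \<in> R\<close>])
    then show ?thesis
      using R(2) by (intro exI[of _ U]) blast
  qed
  then obtain U where U: "\<forall>n. openin X (U n)" "\<forall>n. zero \<in> U n"
    and UC: "\<And>n. H \<inter> X closure_of U n \<subseteq> C n"
    by metis
  have "H \<inter> (\<Inter>n. X closure_of U n) \<subseteq> \<Inter>(range C)"
    using UC by fast
  with U show thesis
    unfolding C(2) by (rule that)
qed

text \<open>For two points of \<open>V\<close> in the same coset, y = x+h with \<open>h\<close> in
  \<open>H\<close>, this confines \<open>h\<close> to a compact set.\<close>

lemma small_neighbourhood_zero:
  assumes "zero \<in> H" "locally_compact_space (subtopology X H)"
  obtains K V where "compactin X K" "K \<subseteq> H" "openin X V" "zero \<in> V"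
    "\<forall>x\<in>V. \<forall>y\<in>V. add (neg x) y \<in> H \<longrightarrow> add (neg x) y \<in> K"
proof -
  have "zero \<in> topspace (subtopology X H)"
    using assms(1) by (simp add: zero_closed)
  then obtain T K where T: "openin (subtopology X H) T" "zero \<in> T" "T \<subseteq> K"
    and K: "compactin (subtopology X H) K"
    using assms(2) unfolding locally_compact_space_def by meson
  obtain N where N: "openin X N" "T = N \<inter> H"
    using T(1) by (auto simp: openin_subtopology)
  have z: "add (neg zero) zero \<in> N"
    using N(2) T(2) by (simp add: zero_closed add_neg_left)
  obtain V where "openin X V" "zero \<in> V" "\<forall>x\<in>V. \<forall>y\<in>V. add (neg x) y \<in> N"
    by (rule square_neighbourhood[OF continuous_left_difference N(1) zero_closed z])
  then show thesis
    using K N(2) T(3) by (intro that[of K V]) (auto simp: compactin_subtopology)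
qed

text \<open>The alternative \<open>b n = zero\<close> admits indices without a lift of
  \<open>y n\<close>; such terms lie in every neighborhood of the limit.\<close>

lemma limitin_zero_if_cosets_converge:
  fixes U :: "nat \<Rightarrow> 'a set"
  assumes H: "strong_subgyrogroup (topspace X) add gyr H"
    and K: "compactin X K" "K \<subseteq> H" and V: "openin X V" "zero \<in> V"
    and VK: "\<forall>x\<in>V. \<forall>y\<in>V. add (neg x) y \<in> H \<longrightarrow> add (neg x) y \<in> K"
    and U: "\<And>n. openin X (U n)" "H \<inter> (\<Inter>n. X closure_of U n) \<subseteq> {zero}"
    and y: "limitin (coset_space X add H) y (left_coset add H zero) sequentially"
    and b: "\<And>n. b n = zero \<or> b n \<in> V \<inter> (\<Inter>i\<le>n. U i) \<and> left_coset add H (b n) = y n"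
  shows "limitin X b zero sequentially"
  unfolding limitin_def
proof (intro conjI allI impI)
  show "zero \<in> topspace X"
    by (rule zero_closed)
  fix P assume P: "openin X P \<and> zero \<in> P"
  have H0: "zero \<in> H" and HX: "H \<subseteq> topspace X"
    using H zero_in_subgyrogroup by (auto simp: strong_subgyrogroup_def subgyrogroup_def)
  define D where "D i = topspace X - X closure_of U i" for i
  have D: "openin X (D i)" for i
    unfolding D_def by (intro openin_diff openin_topspace closedin_closure_of)
  have "K \<subseteq> P \<union> (\<Union>i. D i)"
  proof
    fix k assume k: "k \<in> K"
    show "k \<in> P \<union> (\<Union>i. D i)"
    proof (cases "k = zero")
      case False
      then have "k \<notin> (\<Inter>n. X closure_of U n)"
        using k K(2) U(2) by blast
      then show ?thesis
        using k K(2) HX by (auto simp: D_def)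
    qed (use P in simp)
  qed
  then obtain m where m: "K \<subseteq> P \<union> (\<Union>i\<le>m. D i)"
    by (rule compactin_Un_UNION_initial[OF K(1) conjunct1[OF P] D])
  have Q: "openin X (P \<union> (\<Union>i\<le>m. D i))"
    using P D by (intro openin_Un openin_Union) auto
  obtain W where W: "openin X W" "zero \<in> W"
    and WK: "\<forall>w\<in>W. \<forall>h\<in>K. add w h \<in> P \<union> (\<Union>i\<le>m. D i)"
    by (rule tube_neighbourhood_zero[OF K(1) Q m])
  \<comment> \<open>Intersecting with \<open>V\<close> puts the representative \<open>w\<close>
    found below into \<open>V\<close>, as \<open>VK\<close> requires for the difference of
    \<open>w\<close> and \<open>b n\<close>.\<close>
  have "openin (coset_space X add H) (left_coset add H ` (W \<inter> V))"
    using open_map_left_coset[OF H] W(1) V(1) by (simp add: open_map_def openin_Int)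
  moreover have "left_coset add H zero \<in> left_coset add H ` (W \<inter> V)"
    using W(2) V(2) by blast
  ultimately have "\<forall>\<^sub>F n in sequentially. y n \<in> left_coset add H ` (W \<inter> V)"
    using y by (simp add: limitin_def)
  then show "\<forall>\<^sub>F n in sequentially. b n \<in> P"
    using eventually_ge_at_top[of m]
  proof eventually_elim
    case (elim n)
    show ?case
    proof (cases "b n = zero")
      case False
      then have bV: "b n \<in> V" and bU: "\<And>i. i \<le> m \<Longrightarrow> b n \<in> U i"
        and y_eq: "left_coset add H (b n) = y n"
        using b[of n] elim(2) by auto
      obtain w where w: "w \<in> W" "w \<in> V" "left_coset add H (b n) = left_coset add H w"
        using elim(1) y_eq by auto
      have mem: "b n \<in> topspace X" "w \<in> topspace X"
        using openin_subset[OF V(1)] bV w(2) by auto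
      obtain h where h: "h \<in> H" "b n = add w h"
        using left_coset_eqD[OF H0 mem(1) w(3)] by blast
      have "add (neg w) (b n) = h"
        using h HX mem(2) by (auto simp: add_neg_add)
      then have "h \<in> K"
        using VK[rule_format, OF w(2) bV] h(1) by simp
      then have "b n \<in> P \<union> (\<Union>i\<le>m. D i)"
        using WK w(1) h(2) by simp
      \<comment> \<open>As \<open>n\<close> is at least \<open>m\<close>, the point
        \<open>b n\<close> lies in all of \<open>U 0\<close>, ..., \<open>U m\<close>, whose
        closures are disjoint from the corresponding \<open>D i\<close>; only \<open>P\<close>
        remains.\<close>
      moreover have "b n \<notin> D i" if "i \<le> m" for i
        using closure_of_subset[OF openin_subset[OF U(1)]] bU[OF that] by (auto simp: D_def)
      ultimately show ?thesis
        by auto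
    qed (use P in simp)
  qed
qed

lemma Frechet_Urysohn_at_zero:
  assumes H: "strong_subgyrogroup (topspace X) add gyr H"
    and lc: "locally_compact_space (subtopology X H)"
    and metr: "metrizable_space (subtopology X H)"
    and FU: "strongly_Frechet_Urysohn (coset_space X add H)"
    and A: "\<And>n::nat. zero \<in> X closure_of A n"
  obtains b where "limitin X b zero sequentially" "range b \<subseteq> topspace X" "infinite {n. b n \<in> A n}"
proof -
  let ?\<pi> = "left_coset add H"
  have H0: "zero \<in> H"
    using H zero_in_subgyrogroup by (simp add: strong_subgyrogroup_def)
  obtain K V where K: "compactin X K" "K \<subseteq> H" and V: "openin X V" "zero \<in> V"
    and VK: "\<forall>x\<in>V. \<forall>y\<in>V. add (neg x) y \<in> H \<longrightarrow> add (neg x) y \<in> K"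
    by (rule small_neighbourhood_zero[OF H0 lc])
  obtain U :: "nat \<Rightarrow> 'a set" where U: "\<forall>n. openin X (U n)" "\<forall>n. zero \<in> U n"
    "H \<inter> (\<Inter>n. X closure_of U n) \<subseteq> {zero}"
    by (rule neighbourhoods_separating_zero[OF H0 metr])
  \<comment> \<open>Finite intersections keep \<open>V' n\<close> open, while each fixed
    \<open>U i\<close> contains \<open>V' n\<close> as soon as \<open>n\<close> reaches
    \<open>i\<close>.\<close>
  define V' where "V' n = V \<inter> (\<Inter>i\<le>n. U i)" for n
  have V': "openin X (V' n)" "zero \<in> V' n" for n
    unfolding V'_def using V U by (auto intro!: openin_Int openin_INT2)
  have V'X: "V' n \<subseteq> topspace X" for n
    using V'(1) by (rule openin_subset)
  have \<pi>: "continuous_map X (coset_space X add H) ?\<pi>"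
    unfolding coset_space_def
    by (intro quotient_imp_continuous_map quotient_map_quotient_topology)
  have "?\<pi> zero \<in> coset_space X add H closure_of (?\<pi> ` (V' n \<inter> A n))" for n
  proof -
    have "zero \<in> X closure_of (V' n \<inter> A n)"
      using A V' openin_Int_closure_of_subset by blast
    then show ?thesis
      using continuous_map_image_closure_subset[OF \<pi>] by blast
  qed
  moreover have "?\<pi> ` (V' n \<inter> A n) \<subseteq> topspace (coset_space X add H)" for n
    using V'X by (auto simp: coset_space_def topspace_quotient_topology)
  moreover have "?\<pi> zero \<in> topspace (coset_space X add H)"
    by (simp add: coset_space_def topspace_quotient_topology zero_closed)
  ultimately obtain y where y: "limitin (coset_space X add H) y (?\<pi> zero) sequentially"
    and inf: "infinite {n. y n \<in> ?\<pi> ` (V' n \<inter> A n)}"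
    using FU[unfolded strongly_Frechet_Urysohn_def,
        rule_format, of "?\<pi> zero" "\<lambda>n. ?\<pi> ` (V' n \<inter> A n)"]
    by blast
  \<comment> \<open>The default \<open>zero\<close> fills the indices where \<open>y n\<close>
    misses the image; at the infinitely many others the lift is chosen inside
    \<open>A n\<close>.\<close>
  have "\<exists>c. if y n \<in> ?\<pi> ` (V' n \<inter> A n) then c \<in> V' n \<inter> A n \<and> ?\<pi> c = y n else c = zero" for n
    by (cases "y n \<in> ?\<pi> ` (V' n \<inter> A n)") (force simp: image_iff)+
  then obtain b where b: "\<And>n. if y n \<in> ?\<pi> ` (V' n \<inter> A n)
      then b n \<in> V' n \<inter> A n \<and> ?\<pi> (b n) = y n else b n = zero"
    by metis
  have bz: "b n = zero \<or> b n \<in> V' n \<and> ?\<pi> (b n) = y n" for n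
    using b[of n] by (auto split: if_splits)
  show thesis
  proof (rule that)
    show "limitin X b zero sequentially"
      using limitin_zero_if_cosets_converge[OF H K V VK U(1)[rule_format] U(3) y] bz unfolding V'_def by blast
    show "range b \<subseteq> topspace X"
      using bz V'X zero_closed by (metis image_subsetI subsetD)
    have "{n. y n \<in> ?\<pi> ` (V' n \<inter> A n)} \<subseteq> {n. b n \<in> A n}"
      using b by (metis (mono_tags, lifting) IntD2 mem_Collect_eq subsetI)
    then show "infinite {n. b n \<in> A n}"
      using inf infinite_super by blast
  qed
qed

text \<open>Left translation by \<open>neg x\<close> moves the sets \<open>A n\<close> so that
  \<open>zero\<close> is adherent to them; translation by \<open>x\<close> carries the resulting
  sequence back, since \<open>add x\<close> undoes \<open>add (neg x)\<close>.\<close>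

theorem strongly_Frechet_Urysohn_if_coset_space:
  assumes H: "strong_subgyrogroup (topspace X) add gyr H"
    and "locally_compact_space (subtopology X H)"
    and "metrizable_space (subtopology X H)"
    and "strongly_Frechet_Urysohn (coset_space X add H)"
  shows "strongly_Frechet_Urysohn X"
  unfolding strongly_Frechet_Urysohn_def
proof (intro ballI allI impI)
  fix x and A :: "nat \<Rightarrow> 'a set"
  assume x: "x \<in> topspace X"
    and A: "(\<forall>n. A n \<subseteq> topspace X) \<and> x \<in> (\<Inter>n. X closure_of A n)"
  have "zero \<in> X closure_of (add (neg x) ` A n)" for n
  proof -
    have "add (neg x) x \<in> X closure_of (add (neg x) ` A n)"
      using A continuous_map_image_closure_subset[OF continuous_left_translation[OF neg_closed[OF x]]]
      by blast
    then show ?thesis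
      using x by (simp add: add_neg_left)
  qed
  then obtain b where b: "limitin X b zero sequentially" "range b \<subseteq> topspace X"
    "infinite {n. b n \<in> add (neg x) ` A n}"
    by (rule Frechet_Urysohn_at_zero[OF assms])
  have "{n. b n \<in> add (neg x) ` A n} \<subseteq> {n. add x (b n) \<in> A n}"
    using A x by (auto simp: add_add_neg subset_iff)
  then have "infinite {n. add x (b n) \<in> A n}"
    using b(3) infinite_super by blast
  moreover have "limitin X (\<lambda>n. add x (b n)) x sequentially"
    using continuous_map_limit[OF continuous_left_translation[OF x] b(1)] x
    by (simp add: o_def add_zero_right)
  moreover have "range (\<lambda>n. add x (b n)) \<subseteq> topspace X"
    using b(2) x by (auto intro: add_closed)
  ultimately show "\<exists>b. range b \<subseteq> topspace X \<and> limitin X b x sequentially \<and> infinite {n. b n \<in> A n}"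
    by blast
qed

end

theorem theorem5p5:
  fixes X :: "'a topology"
    and add :: "'a \<Rightarrow> 'a \<Rightarrow> 'a"
    and gyr :: "'a \<Rightarrow> 'a \<Rightarrow> 'a \<Rightarrow> 'a"
    and H :: "'a set"
  assumes "Hausdorff_space X"
    and "strongly_topological_gyrogroup X add gyr"
    and "strong_subgyrogroup (topspace X) add gyr H"
    and "locally_compact_space (subtopology X H)"
    and "metrizable_space (subtopology X H)"
    and "strongly_Frechet_Urysohn (coset_space X add H)"
  shows "strongly_Frechet_Urysohn X"
proof -
  interpret strongly_topological_gyrogroup X add gyr
    by (rule assms(2))
  show ?thesis
    by (rule strongly_Frechet_Urysohn_if_coset_space[OF assms(3-6)])
qed

end
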